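(* Let $\lambda=\{\lambda_k\}_{k=0}^\infty$ be a sequence of positive real numbers. Then the diagonal operator $T_\lambda$ preserves the set of sign-independently real-rooted polynomials if and only if $\lambda$ is log-concave.
   Context: $T_\lambda:\mathbb{R}[x]\to\mathbb{R}[x]$ is the linear map with $T_\lambda(x^k)=\lambda_kx^k$. The sequence $\lambda$ is log-concave if $\lambda_k^2\ge\lambda_{k-1}\lambda_{k+1}$ for all $k\ge1$. A real-rooted polynomial (all complex roots real) $P=\sum_i a_ix^i$ is sign-independently real-rooted if each polynomial $\sum_i\epsilon_ia_ix^i$ with $\epsilon_i\in\{1,-1\}$ is real-rooted as well. *)

theory Defs
  imports Complex_Main "HOL-Computational_Algebra.Polynomial"
begin

definition diagonal_operator :: "(nat \<Rightarrow> real) \<Rightarrow> real poly \<Rightarrow> real poly" where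
  "diagonal_operator l P = (\<Sum>k\<le>degree P. monom (l k * coeff P k) k)"

lemma coeff_diagonal_operator: "coeff (diagonal_operator l P) k = l k * coeff P k"
  by (simp add: diagonal_operator_def coeff_sum coeff_eq_0)

lemma diagonal_operator_add:
  "diagonal_operator l (P + Q) = diagonal_operator l P + diagonal_operator l Q"
  by (simp add: poly_eq_iff coeff_diagonal_operator algebra_simps)

lemma diagonal_operator_smult:
  "diagonal_operator l (smult c P) = smult c (diagonal_operator l P)"
  by (simp add: poly_eq_iff coeff_diagonal_operator)

lemma diagonal_operator_monom: "diagonal_operator l (monom 1 k) = smult (l k) (monom 1 k)"
  by (simp add: poly_eq_iff coeff_diagonal_operator)

definition log_concave :: "(nat \<Rightarrow> real) \<Rightarrow> bool" where
  "log_concave l \<longleftrightarrow> (\<forall>k\<ge>1. (l k)\<^sup>2 \<ge> l (k - 1) * l (k + 1))"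

(* The zero polynomial is not real-rooted, since every complex number is a root of it. *)
definition real_rooted :: "real poly \<Rightarrow> bool" where
  "real_rooted P \<longleftrightarrow> (\<forall>z::complex. poly (map_poly complex_of_real P) z = 0 \<longrightarrow> z \<in> \<real>)"

definition sign_independently_real_rooted :: "real poly \<Rightarrow> bool" where
  "sign_independently_real_rooted P \<longleftrightarrow>
     real_rooted P \<and>
     (\<forall>e :: nat \<Rightarrow> real. (\<forall>i. e i \<in> {1, -1}) \<longrightarrow>
        real_rooted (\<Sum>i\<le>degree P. monom (e i * coeff P i) i))"

end

theory Submission
  imports Defs "HOL-Computational_Algebra.Fundamental_Theorem_Algebra"
begin

text \<open>
  Sign-independent real-rootedness of a nonzero polynomial \<open>\<Sum> a\<^sub>i x\<^sup>i\<close> of degree \<open>n\<close> turns out to be a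
  condition on the absolute values of the coefficients: if \<open>m\<close> is the least index of a nonzero
  coefficient, then for each \<open>k\<close> strictly between \<open>m\<close> and \<open>n\<close> there must be some \<open>r > 0\<close> at which the
  \<open>k\<close>-th term dominates, \<open>\<bar>a\<^sub>k\<bar> r\<^sup>k \<ge> (\<Sum>i\<noteq>k. \<bar>a\<^sub>i\<bar> r\<^sup>i)\<close>
  (lemma \<open>sign_independently_real_rooted_iff\<close>).

  Necessity: choose the signs so that the \<open>k\<close>-th coefficient is \<open>- \<bar>a\<^sub>k\<bar>\<close> and every other one is
  \<open>\<bar>a\<^sub>i\<bar>\<close>. If no \<open>r\<close> exists, this polynomial is positive on the positive reals. Being real-rooted, it
  is then a positive constant times a product of factors \<open>x + c\<close> with \<open>c \<ge> 0\<close>, and all its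
  coefficients between the lowest and the leading one are positive
  (\<open>real_rooted_coeff_pos_between\<close>), which the \<open>k\<close>-th is not.

  Sufficiency: suppose first that each term from the lowest to the leading one dominates strictly
  at some \<open>r\<^sub>k\<close>. The signs at \<open>\<plusminus>r\<^sub>k\<close> are then known, and the intermediate value theorem gives, for
  each \<open>k\<close> with \<open>m \<le> k < n\<close>, a root with absolute value between \<open>r\<^sub>k\<close> and the next
  radius; these are all the nonzero roots (\<open>real_rooted_if_strictly_dominant\<close>).
  The lowest and the leading term always dominate strictly somewhere. Weak dominance becomes strict when \<open>a\<^sub>i\<close> is multiplied by
  \<open>q\<close> raised to \<open>i\<^sup>2\<close> with \<open>0 < q < 1\<close>, and the limit \<open>q \<rightarrow> 1\<close> preserves real-rootedness because of
  the bound \<open>\<bar>p(z)\<bar> \<ge> \<bar>a\<^sub>n\<bar> \<bar>Im z\<bar>\<^sup>n\<close> for real-rooted \<open>p\<close> (\<open>real_rooted_norm_ge\<close>).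

  A positive log-concave sequence \<open>l\<close> has, at each \<open>k \<ge> 1\<close>, a supporting line in logarithmic scale:
  some \<open>s > 0\<close> with \<open>l\<^sub>i s\<^sup>i \<le> l\<^sub>k s\<^sup>k\<close> for all \<open>i\<close>. Replacing \<open>r\<close> by \<open>s r\<close> therefore preserves the
  dominance condition. Conversely, applying the operator to \<open>x\<^sup>m (1 + x)\<^sup>2\<close> gives the log-concavity
  inequality at \<open>m + 1\<close>.
\<close>

section \<open>Real-rooted polynomials\<close>

abbreviation cpoly :: "real poly \<Rightarrow> complex poly" where
  "cpoly \<equiv> map_poly complex_of_real"

lemma cpoly_mult: "cpoly (p * q) = cpoly p * cpoly q"
  by (rule poly_eqI) (simp add: coeff_map_poly coeff_mult)

lemma poly_cpoly_of_real: "poly (cpoly p) (of_real x) = of_real (poly p x)"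
  by (induction p) (auto simp: map_poly_pCons)

lemma degree_cpoly: "degree (cpoly p) = degree p"
  by (rule degree_map_poly) auto

text \<open>
  Real-rooted polynomials are the products of a nonzero constant and real linear factors; this is
  the corresponding induction principle.
\<close>
lemma real_rooted_induct [consumes 1, case_names const linear_mult]:
  assumes "real_rooted p"
  assumes const: "\<And>c. c \<noteq> 0 \<Longrightarrow> Q [:c:]"
  assumes step: "\<And>x p. real_rooted p \<Longrightarrow> p \<noteq> 0 \<Longrightarrow> Q p \<Longrightarrow> Q ([:- x, 1:] * p)"
  shows "Q p"
  using assms(1)
proof (induction "degree p" arbitrary: p)
  case 0
  then obtain c where c: "p = [:c:]"
    by (metis degree_eq_zeroE)
  have "c \<noteq> 0"
  proof
    assume "c = 0"
    with 0 c have "\<i> \<in> \<real>"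
      by (auto simp: real_rooted_def)
    then show False
      by (simp add: complex_is_Real_iff)
  qed
  with c const show ?case
    by simp
next
  case (Suc n)
  have "\<not> constant (poly (cpoly p))"
    using Suc.hyps(2) by (simp add: constant_degree degree_cpoly)
  then obtain z where z: "poly (cpoly p) z = 0"
    using fundamental_theorem_of_algebra by blast
  then obtain x where "z = of_real x"
    using Suc.prems by (auto simp: real_rooted_def elim: Reals_cases)
  then have "poly p x = 0"
    using z by (simp add: poly_cpoly_of_real)
  then obtain q where q: "p = [:- x, 1:] * q"
    by (metis poly_eq_0_iff_dvd dvdE)
  have "q \<noteq> 0"
    using q Suc.hyps(2) by auto
  then have "degree p = Suc (degree q)"
    using q by (simp add: degree_mult_eq del: mult_pCons_left)
  moreover have "real_rooted q"
    using Suc.prems by (auto simp: real_rooted_def q cpoly_mult simp del: mult_pCons_left)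
  ultimately show ?case
    using Suc.hyps \<open>q \<noteq> 0\<close> q step by simp
qed

text \<open>
  A quantitative form of real-rootedness that is preserved under limits of the coefficients.
\<close>
lemma real_rooted_norm_ge:
  assumes "real_rooted p"
  shows "\<bar>lead_coeff p\<bar> * \<bar>Im z\<bar> ^ degree p \<le> norm (poly (cpoly p) z)"
  using assms
proof (induction p rule: real_rooted_induct)
  case (const c)
  then show ?case
    by (simp add: map_poly_pCons)
next
  case (linear_mult x p)
  have "\<bar>Im z\<bar> \<le> norm (z - of_real x)"
    using abs_Im_le_cmod[of "z - of_real x"] by simp
  then have "\<bar>Im z\<bar> * (\<bar>lead_coeff p\<bar> * \<bar>Im z\<bar> ^ degree p)
      \<le> norm (z - of_real x) * norm (poly (cpoly p) z)"
    using linear_mult.IH by (intro mult_mono) auto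
  moreover have "poly (cpoly ([:- x, 1:] * p)) z = (z - of_real x) * poly (cpoly p) z"
    unfolding cpoly_mult by (simp add: map_poly_pCons algebra_simps)
  moreover have "\<bar>lead_coeff ([:- x, 1:] * p)\<bar> * \<bar>Im z\<bar> ^ degree ([:- x, 1:] * p)
      = \<bar>Im z\<bar> * (\<bar>lead_coeff p\<bar> * \<bar>Im z\<bar> ^ degree p)"
    using linear_mult.hyps unfolding lead_coeff_mult
    by (simp add: degree_mult_eq del: mult_pCons_left)
  ultimately show ?case
    by (simp only: norm_mult)
qed

text \<open>
  A real-rooted polynomial with positive leading coefficient and no positive root is a product of
  factors \<open>x + c\<close> with \<open>c \<ge> 0\<close>. Multiplication by such a factor keeps the coefficients nonnegative
  and creates no gap above a positive coefficient.
\<close>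
lemma real_rooted_coeffs_pos:
  assumes "real_rooted p" and "lead_coeff p > 0" and "\<And>x. x > 0 \<Longrightarrow> poly p x \<noteq> 0"
  shows "coeff p i \<ge> 0 \<and> (i < degree p \<longrightarrow> coeff p i > 0 \<longrightarrow> coeff p (Suc i) > 0)"
  using assms
proof (induction p arbitrary: i rule: real_rooted_induct)
  case (const c)
  then show ?case
    by (cases i) auto
next
  case (linear_mult x p)
  have x: "x \<le> 0"
    using linear_mult.prems(2)[of x] by force
  have "lead_coeff ([:- x, 1:] * p) = lead_coeff p"
    unfolding lead_coeff_mult by simp
  then have IH: "coeff p j \<ge> 0" "j < degree p \<Longrightarrow> coeff p j > 0 \<Longrightarrow> coeff p (Suc j) > 0" for j
    using linear_mult.IH[of j] linear_mult.prems by auto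
  have deg: "degree ([:- x, 1:] * p) = Suc (degree p)"
    using linear_mult.hyps by (simp add: degree_mult_eq del: mult_pCons_left)
  have c0: "coeff ([:- x, 1:] * p) 0 = - x * coeff p 0"
    and cSuc: "coeff ([:- x, 1:] * p) (Suc j) = - x * coeff p (Suc j) + coeff p j" for j
    by simp_all
  have nn: "- x * coeff p j \<ge> 0" for j
    using x IH(1)[of j] by (simp add: mult_nonpos_nonneg)
  have nonneg: "coeff ([:- x, 1:] * p) i \<ge> 0"
  proof (cases i)
    case 0
    then show ?thesis unfolding 0 c0 using nn by blast
  next
    case (Suc j)
    show ?thesis unfolding Suc cSuc using nn[of "Suc j"] IH(1)[of j] by linarith
  qed
  moreover have "coeff ([:- x, 1:] * p) (Suc i) > 0"
    if i: "i < Suc (degree p)" and pos: "coeff ([:- x, 1:] * p) i > 0"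
  proof -
    have "coeff p i > 0"
    proof (rule ccontr)
      assume "\<not> coeff p i > 0"
      then have z: "coeff p i = 0"
        using IH(1)[of i] by linarith
      then obtain j where j: "i = Suc j"
        using pos c0 by (cases i) auto
      have "coeff p j > 0"
        using pos z unfolding j cSuc by simp
      then show False
        using IH(2)[of j] i z j by simp
    qed
    then show ?thesis
      unfolding cSuc using nn[of "Suc i"] by linarith
  qed
  ultimately show ?case
    unfolding deg by blast
qed

lemma real_rooted_coeff_pos_between:
  assumes "real_rooted p" and "lead_coeff p > 0" and "\<And>x. x > 0 \<Longrightarrow> poly p x \<noteq> 0"
    and "coeff p i \<noteq> 0" and "i \<le> k" and "k \<le> degree p"
  shows "coeff p k > 0"
  using assms(5,6)
proof (induction k rule: dec_induct)
  case base
  then show ?case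
    using real_rooted_coeffs_pos[OF assms(1-3), of i] assms(4) by auto
next
  case (step k)
  then show ?case
    using real_rooted_coeffs_pos[OF assms(1-3), of k] by auto
qed

section \<open>Dominant terms\<close>

text \<open>The sum of the absolute values at \<open>r \<ge> 0\<close> of all terms of \<open>p\<close> but the \<open>k\<close>-th.\<close>
definition others :: "real poly \<Rightarrow> nat \<Rightarrow> real \<Rightarrow> real" where
  "others p k r = (\<Sum>i\<in>{..degree p} - {k}. \<bar>coeff p i\<bar> * r ^ i)"

lemma term_le_others:
  assumes "i \<noteq> k" and "r \<ge> 0"
  shows "\<bar>coeff p i\<bar> * r ^ i \<le> others p k r"
proof (cases "i \<le> degree p")
  case True
  then show ?thesis
    unfolding others_def using assms by (intro member_le_sum) auto
next
  case False
  then show ?thesis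
    using assms by (auto simp: coeff_eq_0 others_def intro!: sum_nonneg)
qed

lemma others_nonneg: "r \<ge> 0 \<Longrightarrow> others p k r \<ge> 0"
  by (auto simp: others_def intro!: sum_nonneg)

lemma poly_minus_term_le:
  assumes "k \<le> degree p"
  shows "\<bar>poly p x - coeff p k * x ^ k\<bar> \<le> others p k \<bar>x\<bar>"
proof -
  have "poly p x - coeff p k * x ^ k = (\<Sum>i\<in>{..degree p} - {k}. coeff p i * x ^ i)"
    using assms by (simp add: poly_altdef sum.remove[of "{..degree p}" k])
  then show ?thesis
    unfolding others_def by (auto intro: order_trans[OF sum_abs] simp: abs_mult power_abs)
qed

text \<open>
  Each term strictly between the lowest and the leading one dominates the sum of all other terms at
  some positive real. The position above the lowest term is expressed by the presence of a
  nonzero coefficient with smaller index.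
\<close>
definition inner_terms_dominant :: "real poly \<Rightarrow> bool" where
  "inner_terms_dominant p \<longleftrightarrow>
     (\<forall>i k. i < k \<longrightarrow> k < degree p \<longrightarrow> coeff p i \<noteq> 0 \<longrightarrow>
        (\<exists>r>0. others p k r \<le> \<bar>coeff p k\<bar> * r ^ k))"

lemma lowest_term_dominant:
  assumes "coeff p m \<noteq> 0" and "\<And>i. i < m \<Longrightarrow> coeff p i = 0"
  shows "\<exists>r>0. others p m r < \<bar>coeff p m\<bar> * r ^ m"
proof -
  define S where "S = (\<Sum>i\<le>degree p. \<bar>coeff p i\<bar>)"
  define r where "r = min 1 (\<bar>coeff p m\<bar> / (S + 1))"
  have S: "S \<ge> 0"
    unfolding S_def by (intro sum_nonneg) auto
  have r: "r > 0" "r \<le> 1" "r * (S + 1) \<le> \<bar>coeff p m\<bar>"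
  proof -
    have "r \<le> \<bar>coeff p m\<bar> / (S + 1)"
      by (simp add: r_def)
    then show "r * (S + 1) \<le> \<bar>coeff p m\<bar>"
      using S by (simp add: pos_le_divide_eq)
  qed (use S assms(1) in \<open>auto simp: r_def\<close>)
  have "others p m r \<le> (\<Sum>i\<in>{..degree p} - {m}. \<bar>coeff p i\<bar> * r ^ Suc m)"
    unfolding others_def
  proof (rule sum_mono)
    fix i assume i: "i \<in> {..degree p} - {m}"
    show "\<bar>coeff p i\<bar> * r ^ i \<le> \<bar>coeff p i\<bar> * r ^ Suc m"
    proof (cases "i < m")
      case False
      then show ?thesis
        using i r by (intro mult_left_mono power_decreasing) auto
    qed (simp add: assms(2))
  qed
  also have "\<dots> \<le> S * r ^ Suc m"
    unfolding S_def sum_distrib_right using r by (intro sum_mono2) auto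
  also have "\<dots> < (r * (S + 1)) * r ^ m"
    using r by (simp add: algebra_simps)
  also have "\<dots> \<le> \<bar>coeff p m\<bar> * r ^ m"
    using r by (intro mult_right_mono) auto
  finally show ?thesis
    using r by blast
qed

lemma leading_term_dominant:
  assumes "p \<noteq> 0"
  shows "\<exists>r>0. others p (degree p) r < \<bar>lead_coeff p\<bar> * r ^ degree p"
proof -
  define n where "n = degree p"
  define S where "S = (\<Sum>i\<le>n. \<bar>coeff p i\<bar>)"
  define r where "r = (S + 1) / \<bar>lead_coeff p\<bar> + 1"
  have S: "S \<ge> 0"
    unfolding S_def by (intro sum_nonneg) auto
  have l: "\<bar>lead_coeff p\<bar> > 0"
    using assms by simp
  have r: "r \<ge> 1" "S < \<bar>lead_coeff p\<bar> * r"
  proof -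
    have "\<bar>lead_coeff p\<bar> * r = S + 1 + \<bar>lead_coeff p\<bar>"
      using l unfolding r_def distrib_left by simp
    then show "S < \<bar>lead_coeff p\<bar> * r"
      by simp
  qed (use S in \<open>simp add: r_def\<close>)
  have "r * others p n r \<le> (\<Sum>i\<in>{..n} - {n}. \<bar>coeff p i\<bar> * r ^ n)"
    unfolding others_def sum_distrib_left n_def[symmetric]
  proof (rule sum_mono)
    fix i assume i: "i \<in> {..n} - {n}"
    then have "\<bar>coeff p i\<bar> * r ^ Suc i \<le> \<bar>coeff p i\<bar> * r ^ n"
      using r by (intro mult_left_mono power_increasing) auto
    then show "r * (\<bar>coeff p i\<bar> * r ^ i) \<le> \<bar>coeff p i\<bar> * r ^ n"
      by (simp add: mult_ac)
  qed
  also have "\<dots> \<le> S * r ^ n"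
    unfolding S_def sum_distrib_right using r by (intro sum_mono2) auto
  also have "\<dots> < (\<bar>lead_coeff p\<bar> * r) * r ^ n"
    using r by (intro mult_strict_right_mono) auto
  finally have "r * others p n r < r * (\<bar>lead_coeff p\<bar> * r ^ n)"
    by (simp add: mult_ac)
  then have "others p n r < \<bar>lead_coeff p\<bar> * r ^ n"
    using r by simp
  moreover have "r > 0"
    using r by simp
  ultimately show ?thesis
    unfolding n_def by blast
qed

section \<open>Dominant terms force real roots\<close>

lemma sgn_poly_dominant:
  assumes "k \<le> degree p" and "others p k \<bar>x\<bar> < \<bar>coeff p k\<bar> * \<bar>x\<bar> ^ k"
  shows "sgn (poly p x) = sgn (coeff p k * x ^ k)"
proof -
  have "\<bar>poly p x - coeff p k * x ^ k\<bar> < \<bar>coeff p k * x ^ k\<bar>"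
    using poly_minus_term_le[OF assms(1), of x] assms(2) by (simp add: abs_mult power_abs)
  moreover have "sgn a = sgn b" if "\<bar>a - b\<bar> < \<bar>b\<bar>" for a b :: real
    using that by (auto simp: sgn_if)
  ultimately show ?thesis
    by blast
qed

text \<open>
  If the \<open>k\<close>-th term dominates strictly at \<open>r\<close> and the next one at \<open>s\<close>, then \<open>r < s\<close>, since the
  absolute value of the quotient of the two coefficients lies strictly between \<open>r\<close> and \<open>s\<close>.
  The polynomial changes sign between \<open>r\<close> and \<open>s\<close> if the two coefficients have opposite signs,
  and between \<open>-s\<close> and \<open>-r\<close> otherwise.
\<close>
lemma root_between_dominant:
  assumes "k < degree p" and "0 < r" and "0 < s"
    and r: "others p k r < \<bar>coeff p k\<bar> * r ^ k"
    and s: "others p (Suc k) s < \<bar>coeff p (Suc k)\<bar> * s ^ Suc k"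
  obtains x where "poly p x = 0" "r < \<bar>x\<bar>" "\<bar>x\<bar> < s"
proof -
  have nz: "coeff p k \<noteq> 0" "coeff p (Suc k) \<noteq> 0"
    using r s others_nonneg[of r p k] others_nonneg[of s p "Suc k"] assms(2,3) by auto
  have "\<bar>coeff p (Suc k)\<bar> * r ^ Suc k < \<bar>coeff p k\<bar> * r ^ k"
    using term_le_others[of "Suc k" k r p] r assms(2) by linarith
  then have "\<bar>coeff p (Suc k)\<bar> * r < \<bar>coeff p k\<bar>"
    using assms(2) by simp
  moreover have "\<bar>coeff p k\<bar> * s ^ k < \<bar>coeff p (Suc k)\<bar> * s ^ Suc k"
    using term_le_others[of k "Suc k" s p] s assms(3) by linarith
  then have "\<bar>coeff p k\<bar> < \<bar>coeff p (Suc k)\<bar> * s"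
    using assms(3) by simp
  ultimately have "\<bar>coeff p (Suc k)\<bar> * r < \<bar>coeff p (Suc k)\<bar> * s"
    by linarith
  then have rs: "r < s"
    using nz by simp
  show thesis
  proof (cases "coeff p k * coeff p (Suc k) < 0")
    case True
    have "sgn (poly p r) = sgn (coeff p k)" "sgn (poly p s) = sgn (coeff p (Suc k))"
      using sgn_poly_dominant[of k p r] sgn_poly_dominant[of "Suc k" p s] r s assms(1-3)
      by (auto simp: sgn_mult)
    then have "sgn (poly p r * poly p s) = sgn (coeff p k * coeff p (Suc k))"
      by (simp add: sgn_mult)
    then have "poly p r * poly p s < 0"
      using True by (metis sgn_less)
    then obtain x where "r < x" "x < s" "poly p x = 0"
      using poly_IVT[OF rs] by blast
    then show thesis
      using that[of x] assms(2) by simp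
  next
    case False
    have "sgn (poly p (- r)) = sgn (coeff p k * (- r) ^ k)"
      "sgn (poly p (- s)) = sgn (coeff p (Suc k) * (- s) ^ Suc k)"
      using sgn_poly_dominant[of k p "- r"] sgn_poly_dominant[of "Suc k" p "- s"] r s assms(1-3)
      by auto
    then have "sgn (poly p (- s) * poly p (- r))
        = sgn (- (coeff p k * coeff p (Suc k)) * (((- r) ^ k * (- s) ^ k) * s))"
      by (simp add: sgn_mult mult_ac)
    also have "\<dots> = sgn (- (coeff p k * coeff p (Suc k)) * ((r * s) ^ k * s))"
      by (simp flip: power_mult_distrib)
    also have "\<dots> = -1"
    proof -
      have "coeff p k * coeff p (Suc k) \<noteq> 0"
        using nz by simp
      then have "- (coeff p k * coeff p (Suc k)) < 0"
        using False by linarith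
      then have "- (coeff p k * coeff p (Suc k)) * ((r * s) ^ k * s) < 0"
        using assms(2,3) by (intro mult_neg_pos) auto
      then show ?thesis by simp
    qed
    finally have "poly p (- s) * poly p (- r) < 0"
      by (simp only: sgn_1_neg)
    then obtain x where "- s < x" "x < - r" "poly p x = 0"
      using poly_IVT[of "- s" "- r" p] rs by auto
    then show thesis
      using that[of x] assms(2) by simp
  qed
qed

text \<open>
  The roots found between consecutive radii have distinct nonzero absolute values, and their number
  is the degree of the cofactor of \<open>x\<^sup>m\<close> in \<open>p\<close>; so this cofactor has no other complex root.
\<close>
lemma real_rooted_if_strictly_dominant:
  assumes m: "coeff p m \<noteq> 0" "\<And>i. i < m \<Longrightarrow> coeff p i = 0"
    and dom: "\<And>k. m \<le> k \<Longrightarrow> k \<le> degree p \<Longrightarrow> \<exists>r>0. others p k r < \<bar>coeff p k\<bar> * r ^ k"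
  shows "real_rooted p"
proof -
  define n where "n = degree p"
  have mn: "m \<le> n"
    using m(1) le_degree n_def by blast
  have "p = monom 1 m * poly_shift m p"
    using m(2) by (auto simp: poly_eq_iff coeff_monom_mult coeff_poly_shift)
  then obtain q where q: "p = monom 1 m * q"
    by blast
  have "p \<noteq> 0" "q \<noteq> 0"
    using m(1) q by auto
  then have degq: "degree q = n - m"
    unfolding n_def q by (simp add: degree_mult_eq degree_monom_eq)
  obtain r where r: "\<And>k. m \<le> k \<Longrightarrow> k \<le> n \<Longrightarrow> r k > 0"
    "\<And>k. m \<le> k \<Longrightarrow> k \<le> n \<Longrightarrow> others p k (r k) < \<bar>coeff p k\<bar> * r k ^ k"
    using dom unfolding n_def by metis
  have "\<exists>x. poly p x = 0 \<and> r k < \<bar>x\<bar> \<and> \<bar>x\<bar> < r (Suc k)" if "m \<le> k" "k < n" for k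
    using root_between_dominant[of k p "r k" "r (Suc k)"] r[of k] r[of "Suc k"] that
    unfolding n_def by (metis Suc_leI le_Suc_eq less_imp_le_nat)
  then obtain f where f: "\<And>k. m \<le> k \<Longrightarrow> k < n \<Longrightarrow> poly p (f k) = 0"
    "\<And>k. m \<le> k \<Longrightarrow> k < n \<Longrightarrow> r k < \<bar>f k\<bar>" "\<And>k. m \<le> k \<Longrightarrow> k < n \<Longrightarrow> \<bar>f k\<bar> < r (Suc k)"
    by metis
  have r_mono: "r i \<le> r j" if "m \<le> i" "i \<le> j" "j \<le> n" for i j
    using that(2,3)
  proof (induction j rule: dec_induct)
    case (step j)
    then show ?case
      using f(2,3)[of j] that(1) by force
  qed simp
  have f_mono: "\<bar>f i\<bar> < \<bar>f j\<bar>" if "m \<le> i" "i < j" "j < n" for i j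
    using f(3)[of i] f(2)[of j] r_mono[of "Suc i" j] that by force
  then have inj: "inj_on f {m..<n}"
    by (intro linorder_inj_onI) force+
  define S where "S = complex_of_real ` f ` {m..<n}"
  define R where "R = {z. poly (cpoly q) z = 0}"
  have "card S = n - m"
    unfolding S_def using inj by (simp add: card_image inj_on_def)
  have "S \<subseteq> R"
  proof
    fix z assume "z \<in> S"
    then obtain k where k: "m \<le> k" "k < n" "z = of_real (f k)"
      by (auto simp: S_def)
    have "f k \<noteq> 0"
      using f(2)[of k] r(1)[of k] k by auto
    moreover have "poly p (f k) = 0"
      using f(1) k by blast
    ultimately have "poly q (f k) = 0"
      by (simp add: q poly_monom)
    then show "z \<in> R"
      using k by (simp add: R_def poly_cpoly_of_real)
  qed
  have "cpoly q \<noteq> 0"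
    using \<open>q \<noteq> 0\<close> by (simp add: map_poly_eq_0_iff)
  then have "finite R" "card R \<le> n - m"
    using poly_roots_finite[of "cpoly q"] card_poly_roots_bound[of "cpoly q"] degq
    by (auto simp: R_def degree_cpoly)
  then have "S = R"
    using \<open>S \<subseteq> R\<close> \<open>card S = n - m\<close> by (intro card_seteq) auto
  show ?thesis
    unfolding real_rooted_def
  proof (intro allI impI)
    fix z assume "poly (cpoly p) z = 0"
    then have "z ^ m = 0 \<or> z \<in> R"
      by (simp add: q cpoly_mult map_poly_monom poly_monom R_def)
    then show "z \<in> \<real>"
      using \<open>S = R\<close> by (auto simp: S_def)
  qed
qed

section \<open>Diagonal operators and dominant terms\<close>

lemma coeff_diagonal_operator_eq_0_iff:
  assumes "\<And>k. l k > 0"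
  shows "coeff (diagonal_operator l p) k = 0 \<longleftrightarrow> coeff p k = 0"
  using assms[of k] by (simp add: coeff_diagonal_operator)

lemma degree_diagonal_operator:
  assumes "\<And>k. l k > 0"
  shows "degree (diagonal_operator l p) = degree p"
  by (simp add: degree_def coeff_diagonal_operator_eq_0_iff[OF assms])

lemma others_diagonal_operator:
  assumes "\<And>k. l k > 0"
  shows "others (diagonal_operator l p) k r
    = (\<Sum>i\<in>{..degree p} - {k}. l i * \<bar>coeff p i\<bar> * r ^ i)"
  using assms by (simp add: others_def degree_diagonal_operator coeff_diagonal_operator abs_mult
      less_imp_le)

text \<open>
  Dominance at \<open>r\<close> is carried by a diagonal operator to dominance at \<open>s r\<close>, with a factor \<open>c\<close>, if
  the weights satisfy \<open>l\<^sub>i s\<^sup>i \<le> c l\<^sub>k s\<^sup>k\<close>. The case \<open>c = 1\<close> serves for log-concave weights, the case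
  \<open>c < 1\<close> for turning weak dominance into strict dominance.
\<close>
lemma dominance_diagonal_operator:
  assumes pos: "\<And>k. l k > 0" and "r > 0" and "s > 0"
    and dom: "others p k r \<le> \<bar>coeff p k\<bar> * r ^ k"
    and c: "\<And>i. i \<noteq> k \<Longrightarrow> l i * s ^ i \<le> c * (l k * s ^ k)" and "c \<ge> 0"
  shows "others (diagonal_operator l p) k (s * r)
    \<le> c * (\<bar>coeff (diagonal_operator l p) k\<bar> * (s * r) ^ k)"
proof -
  have "others (diagonal_operator l p) k (s * r)
      = (\<Sum>i\<in>{..degree p} - {k}. (l i * s ^ i) * (\<bar>coeff p i\<bar> * r ^ i))"
    by (simp add: others_diagonal_operator[OF pos] power_mult_distrib mult_ac)
  also have "\<dots> \<le> (\<Sum>i\<in>{..degree p} - {k}. (c * (l k * s ^ k)) * (\<bar>coeff p i\<bar> * r ^ i))"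
    using c \<open>r > 0\<close> by (intro sum_mono mult_right_mono) auto
  also have "\<dots> = (c * (l k * s ^ k)) * others p k r"
    by (simp add: others_def sum_distrib_left)
  also have "\<dots> \<le> (c * (l k * s ^ k)) * (\<bar>coeff p k\<bar> * r ^ k)"
    using dom pos[of k] \<open>c \<ge> 0\<close> \<open>s > 0\<close> by (intro mult_left_mono) auto
  also have "\<dots> = c * (\<bar>coeff (diagonal_operator l p) k\<bar> * (s * r) ^ k)"
    using pos[of k] by (simp add: coeff_diagonal_operator abs_mult power_mult_distrib mult_ac)
  finally show ?thesis .
qed

text \<open>
  After cancellation this says \<open>(i - k)\<^sup>2 \<ge> 1\<close>.
\<close>
lemma power_square_dominance:
  fixes q :: real
  assumes "0 < q" and "q < 1" and "i \<noteq> k"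
  shows "q ^ (i\<^sup>2) * (1 / q ^ (2 * k)) ^ i \<le> q * (q ^ (k\<^sup>2) * (1 / q ^ (2 * k)) ^ k)"
proof -
  have le: "Suc (2 * k * i) \<le> i\<^sup>2 + k\<^sup>2"
  proof -
    have "(int i - int k)\<^sup>2 > 0"
      using assms(3) by simp
    then have "int (Suc (2 * k * i)) \<le> int (i\<^sup>2 + k\<^sup>2)"
      by (simp add: power2_eq_square algebra_simps)
    then show ?thesis
      by linarith
  qed
  have "q ^ (i\<^sup>2) * q ^ (k\<^sup>2) \<le> q * q ^ (2 * k * i)"
    using power_decreasing[OF le, of q] assms(1,2) by (simp add: power_add)
  moreover have "q ^ (2 * k * k) = q ^ (k\<^sup>2) * q ^ (k\<^sup>2)"
    unfolding power_add[symmetric] by (simp add: power2_eq_square mult_2 distrib_right)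
  ultimately show ?thesis
    using assms(1) by (simp add: power_divide field_simps flip: power_mult)
qed

lemma real_rooted_if_inner_terms_dominant:
  assumes "p \<noteq> 0" and dom: "inner_terms_dominant p"
  shows "real_rooted p"
proof -
  define n where "n = degree p"
  define m where "m = (LEAST i. coeff p i \<noteq> 0)"
  have "\<exists>i. coeff p i \<noteq> 0"
    using \<open>p \<noteq> 0\<close> by (auto simp: poly_eq_iff)
  then have m: "coeff p m \<noteq> 0" "\<And>i. i < m \<Longrightarrow> coeff p i = 0"
    unfolding m_def by (rule LeastI_ex) (use not_less_Least in blast)
  \<comment> \<open>a perturbation of \<open>p\<close> that tends to \<open>p\<close> as \<open>q\<close> tends to 1\<close>
  define P where "P = (\<lambda>q. diagonal_operator (\<lambda>i. q ^ (i\<^sup>2)) p)"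
  have rr: "real_rooted (P q)" if q: "0 < q" "q < 1" for q :: real
  proof (rule real_rooted_if_strictly_dominant)
    have pos: "\<And>i. q ^ (i\<^sup>2) > 0"
      using q by simp
    show "coeff (P q) m \<noteq> 0"
      using m q by (simp add: P_def coeff_diagonal_operator)
    show "coeff (P q) i = 0" if "i < m" for i
      using m that by (simp add: P_def coeff_diagonal_operator)
    have deg: "degree (P q) = n"
      unfolding P_def n_def by (rule degree_diagonal_operator[OF pos])
    fix k assume k: "m \<le> k" "k \<le> degree (P q)"
    consider "k = m" | "k = degree (P q)" | "m < k" "k < n"
      using k deg by linarith
    then show "\<exists>r>0. others (P q) k r < \<bar>coeff (P q) k\<bar> * r ^ k"
    proof cases
      case 1
      show ?thesis
        unfolding 1 using m q
        by (intro lowest_term_dominant) (auto simp: P_def coeff_diagonal_operator)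
    next
      case 2
      have "P q \<noteq> 0"
        using m(1) q by (auto simp: poly_eq_iff P_def coeff_diagonal_operator)
      then show ?thesis
        unfolding 2 by (rule leading_term_dominant)
    next
      case 3
      then obtain r where r: "r > 0" "others p k r \<le> \<bar>coeff p k\<bar> * r ^ k"
        using dom m(1) unfolding inner_terms_dominant_def n_def by blast
      have "0 < \<bar>lead_coeff p\<bar> * r ^ n"
        using \<open>p \<noteq> 0\<close> r(1) by simp
      also have "\<dots> \<le> others p k r"
        using term_le_others[of n k r p] 3 r(1) by (simp add: n_def)
      also note r(2)
      finally have "coeff p k \<noteq> 0"
        by auto
      define s where "s = 1 / q ^ (2 * k)"
      have s: "s > 0"
        using q by (simp add: s_def)
      have "others (P q) k (s * r) \<le> q * (\<bar>coeff (P q) k\<bar> * (s * r) ^ k)"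
        unfolding P_def using r s q power_square_dominance[of q _ k]
        by (intro dominance_diagonal_operator pos) (auto simp: s_def)
      also have "\<dots> < \<bar>coeff (P q) k\<bar> * (s * r) ^ k"
        using q s r \<open>coeff p k \<noteq> 0\<close> by (simp add: P_def coeff_diagonal_operator)
      finally show ?thesis
        using s r by (intro exI[of _ "s * r"]) simp
    qed
  qed
  show ?thesis
    unfolding real_rooted_def
  proof (intro allI impI)
    fix z assume z: "poly (cpoly p) z = 0"
    have eq: "poly (cpoly (P q)) z = (\<Sum>i\<le>n. of_real (q ^ (i\<^sup>2) * coeff p i) * z ^ i)"
      and lead: "lead_coeff (P q) = q ^ (n\<^sup>2) * lead_coeff p"
      and deg: "degree (P q) = n" if "q > 0" for q
    proof -
      show deg: "degree (P q) = n"
        unfolding P_def n_def using that by (intro degree_diagonal_operator) simp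
      show "poly (cpoly (P q)) z = (\<Sum>i\<le>n. of_real (q ^ (i\<^sup>2) * coeff p i) * z ^ i)"
        unfolding poly_altdef degree_cpoly deg
        by (simp add: coeff_map_poly P_def coeff_diagonal_operator)
      show "lead_coeff (P q) = q ^ (n\<^sup>2) * lead_coeff p"
        unfolding deg by (simp add: P_def coeff_diagonal_operator n_def)
    qed
    have ev: "\<forall>\<^sub>F q in at_left (1::real). 0 < q \<and> q < 1"
      using eventually_at_left_real[of 0 "1::real"] by simp
    have ineq: "\<forall>\<^sub>F q in at_left (1::real). \<bar>q ^ (n\<^sup>2) * lead_coeff p\<bar> * \<bar>Im z\<bar> ^ n
        \<le> norm (\<Sum>i\<le>n. of_real (q ^ (i\<^sup>2) * coeff p i) * z ^ i)"
      using ev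
    proof eventually_elim
      case (elim q)
      then show ?case
        using real_rooted_norm_ge[OF rr[of q], of z] eq[of q] lead[of q] deg[of q] by simp
    qed
    have lim1: "((\<lambda>q. norm (\<Sum>i\<le>n. of_real (q ^ (i\<^sup>2) * coeff p i) * z ^ i))
        \<longlongrightarrow> norm (\<Sum>i\<le>n. of_real (1 ^ (i\<^sup>2) * coeff p i) * z ^ i)) (at_left (1::real))"
      by (intro tendsto_intros)
    have lim2: "((\<lambda>q. \<bar>q ^ (n\<^sup>2) * lead_coeff p\<bar> * \<bar>Im z\<bar> ^ n)
        \<longlongrightarrow> \<bar>1 ^ (n\<^sup>2) * lead_coeff p\<bar> * \<bar>Im z\<bar> ^ n) (at_left (1::real))"
      by (intro tendsto_intros)
    have "\<bar>1 ^ (n\<^sup>2) * lead_coeff p\<bar> * \<bar>Im z\<bar> ^ n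
        \<le> norm (\<Sum>i\<le>n. of_real (1 ^ (i\<^sup>2) * coeff p i) * z ^ i)"
      by (rule tendsto_le[OF _ lim1 lim2 ineq]) simp
    also have "(\<Sum>i\<le>n. of_real (1 ^ (i\<^sup>2) * coeff p i) * z ^ i) = poly (cpoly p) z"
      unfolding poly_altdef degree_cpoly n_def by (simp add: coeff_map_poly)
    finally have "\<bar>Im z\<bar> ^ n \<le> 0"
      using z \<open>p \<noteq> 0\<close> by (simp add: mult_le_0_iff)
    then have "Im z = 0"
      by (metis abs_le_zero_iff abs_zero power_eq_0_iff power_abs abs_idempotent)
    then show "z \<in> \<real>"
      by (simp add: complex_is_Real_iff)
  qed
qed

section \<open>Sign-independent real-rootedness and diagonal operators\<close>

lemma coeff_sign_change:
  "coeff (\<Sum>i\<le>degree p. monom (e i * coeff p i) i) k = (e k :: real) * coeff p k"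
  by (simp add: coeff_sum coeff_eq_0)

lemma sign_independently_real_rooted_iff:
  "sign_independently_real_rooted p \<longleftrightarrow> p \<noteq> 0 \<and> inner_terms_dominant p"
proof
  assume p: "sign_independently_real_rooted p"
  have "p \<noteq> 0"
  proof
    assume "p = 0"
    then have "\<i> \<in> \<real>"
      using p by (auto simp: sign_independently_real_rooted_def real_rooted_def)
    then show False
      by (simp add: complex_is_Real_iff)
  qed
  moreover have "\<exists>r>0. others p k r \<le> \<bar>coeff p k\<bar> * r ^ k"
    if ik: "i < k" "k < degree p" "coeff p i \<noteq> 0" for i k
  proof (rule ccontr)
    assume none: "\<not> ?thesis"
    \<comment> \<open>signs that make the \<open>k\<close>-th coefficient nonpositive and all others nonnegative\<close>
    define e where "e j = (if (coeff p j \<ge> 0) = (j \<noteq> k) then 1 else - 1 :: real)" for j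
    define f where "f = (\<Sum>i\<le>degree p. monom (e i * coeff p i) i)"
    have "real_rooted f"
      using p unfolding sign_independently_real_rooted_def f_def by (auto simp: e_def)
    have cf: "coeff f j = (if j = k then - \<bar>coeff p j\<bar> else \<bar>coeff p j\<bar>)" for j
      unfolding f_def coeff_sign_change by (auto simp: e_def)
    have deg: "degree f = degree p"
      unfolding degree_def cf by (rule arg_cong[of _ _ Least]) auto
    have "poly f x > 0" if "x > 0" for x
    proof -
      have "poly f x = others p k x - \<bar>coeff p k\<bar> * x ^ k"
        using ik(2) unfolding poly_altdef deg others_def
        by (simp add: sum.remove[of "{..degree p}" k] cf)
      then show ?thesis
        using none that by force
    qed
    then have "coeff f k > 0"
      using \<open>real_rooted f\<close> \<open>p \<noteq> 0\<close> ik
      by (intro real_rooted_coeff_pos_between[of f i k]) (force simp: cf deg)+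
    then show False
      by (simp add: cf)
  qed
  ultimately show "p \<noteq> 0 \<and> inner_terms_dominant p"
    unfolding inner_terms_dominant_def by blast
next
  assume p: "p \<noteq> 0 \<and> inner_terms_dominant p"
  have "real_rooted (\<Sum>i\<le>degree p. monom (e i * coeff p i) i)"
    if e: "\<forall>i. e i \<in> {1, - 1}" for e :: "nat \<Rightarrow> real"
  proof -
    define f where "f = (\<Sum>i\<le>degree p. monom (e i * coeff p i) i)"
    have e': "\<bar>e i\<bar> = 1" for i
      using e[rule_format, of i] by auto
    have abs: "\<bar>coeff f i\<bar> = \<bar>coeff p i\<bar>" for i
      unfolding f_def coeff_sign_change by (simp add: abs_mult e')
    then have nz: "coeff f i = 0 \<longleftrightarrow> coeff p i = 0" for i
      by (metis abs_eq_0)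
    have deg: "degree f = degree p"
      by (simp add: degree_def nz)
    have "f \<noteq> 0"
      using p nz by (auto simp: poly_eq_iff)
    moreover have "inner_terms_dominant f"
      using p by (simp add: inner_terms_dominant_def others_def abs nz deg)
    ultimately show ?thesis
      unfolding f_def[symmetric] by (rule real_rooted_if_inner_terms_dominant)
  qed
  then show "sign_independently_real_rooted p"
    unfolding sign_independently_real_rooted_def using p real_rooted_if_inner_terms_dominant by blast
qed

text \<open>
  The ratios \<open>l (Suc i) / l i\<close> are nonincreasing, so with \<open>s\<close> the inverse of the ratio
  at \<open>k - 1\<close> the sequence \<open>l\<^sub>i s\<^sup>i\<close> is nondecreasing up to \<open>k\<close> and nonincreasing from there on.
\<close>
lemma log_concave_supporting_line:
  assumes pos: "\<And>k. l k > 0" and lc: "log_concave l" and "k \<ge> 1"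
  defines "s \<equiv> l (k - 1) / l k"
  shows "l i * s ^ i \<le> l k * s ^ k"
proof -
  have s: "s > 0"
    using pos by (simp add: s_def)
  have ratio: "l (Suc j) * l (Suc j) \<ge> l j * l (Suc (Suc j))" for j
    using lc[unfolded log_concave_def, rule_format, of "Suc j"] by (simp add: power2_eq_square)
  have dec: "l (Suc j) / l j \<le> l (Suc i) / l i" if "i \<le> j" for i j
    using that
  proof (induction j rule: dec_induct)
    case (step j)
    have "l (Suc (Suc j)) / l (Suc j) \<le> l (Suc j) / l j"
      using ratio[of j] pos[of j] pos[of "Suc j"] by (simp add: field_simps)
    then show ?case
      using step.IH by linarith
  qed simp
  obtain k' where k': "k = Suc k'"
    using \<open>k \<ge> 1\<close> by (cases k) auto
  have s': "s = l k' / l k"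
    by (simp add: s_def k')
  have up: "l j * s ^ j \<le> l (Suc j) * s ^ Suc j" if "j < k" for j
  proof -
    have "l k / l k' \<le> l (Suc j) / l j"
      using dec[of j k'] that k' by simp
    then have "l j \<le> l (Suc j) * s"
      using pos[of j] pos[of k] pos[of k'] by (simp add: s' field_simps)
    then have "l j * s ^ j \<le> (l (Suc j) * s) * s ^ j"
      using s by (intro mult_right_mono) auto
    then show ?thesis
      by (simp add: mult_ac)
  qed
  have down: "l (Suc j) * s ^ Suc j \<le> l j * s ^ j" if "k \<le> j" for j
  proof -
    have "l (Suc j) / l j \<le> l k / l k'"
      using dec[of k' j] that k' by simp
    then have "l (Suc j) * s \<le> l j"
      using pos[of j] pos[of k] pos[of k'] by (simp add: s' field_simps)
    then have "(l (Suc j) * s) * s ^ j \<le> l j * s ^ j"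
      using s by (intro mult_right_mono) auto
    then show ?thesis
      by (simp add: mult_ac)
  qed
  show ?thesis
  proof (cases "i \<le> k")
    case True
    then show ?thesis
    proof (induction i rule: inc_induct)
      case (step i)
      then show ?case
        using up[of i] by linarith
    qed simp
  next
    case False
    then have "k \<le> i"
      by simp
    then show ?thesis
    proof (induction i rule: dec_induct)
      case (step i)
      then show ?case
        using down[of i] by linarith
    qed simp
  qed
qed

lemma log_concave_preserves:
  assumes pos: "\<And>k. l k > 0" and lc: "log_concave l"
    and p: "sign_independently_real_rooted p"
  shows "sign_independently_real_rooted (diagonal_operator l p)"
  unfolding sign_independently_real_rooted_iff
proof
  have dom: "p \<noteq> 0" "inner_terms_dominant p"
    using p by (auto simp: sign_independently_real_rooted_iff)
  show "diagonal_operator l p \<noteq> 0"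
    using dom(1) by (auto simp: poly_eq_iff coeff_diagonal_operator_eq_0_iff[OF pos])
  show "inner_terms_dominant (diagonal_operator l p)"
    unfolding inner_terms_dominant_def degree_diagonal_operator[OF pos]
      coeff_diagonal_operator_eq_0_iff[OF pos]
  proof (intro allI impI)
    fix i k assume ik: "i < k" "k < degree p" "coeff p i \<noteq> 0"
    then obtain r where r: "r > 0" "others p k r \<le> \<bar>coeff p k\<bar> * r ^ k"
      using dom(2) unfolding inner_terms_dominant_def by blast
    define s where "s = l (k - 1) / l k"
    have s: "s > 0"
      using pos by (simp add: s_def)
    have "others (diagonal_operator l p) k (s * r)
        \<le> 1 * (\<bar>coeff (diagonal_operator l p) k\<bar> * (s * r) ^ k)"
      using r s ik log_concave_supporting_line[OF pos lc, of k]
      by (intro dominance_diagonal_operator pos) (auto simp: s_def)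
    then show "\<exists>r>0. others (diagonal_operator l p) k r
        \<le> \<bar>coeff (diagonal_operator l p) k\<bar> * r ^ k"
      using r s by (intro exI[of _ "s * r"]) simp
  qed
qed

lemma sign_independently_real_rooted_trinomial:
  assumes "a > 0" and "b > 0" and "c > 0"
  shows "sign_independently_real_rooted (monom 1 m * [:a, b, c:]) \<longleftrightarrow> 4 * a * c \<le> b\<^sup>2"
proof -
  define p where "p = monom 1 m * [:a, b, c:]"
  have nz: "p \<noteq> 0" and deg: "degree p = m + 2"
    using assms by (auto simp: p_def degree_mult_eq degree_monom_eq simp del: mult_pCons_right)
  have cf: "coeff p i =
      (if i = m then a else if i = m + 1 then b else if i = m + 2 then c else 0)" for i
    by (auto simp: p_def coeff_monom_mult coeff_pCons split: nat.splits)
  have "{..m + 2} - {m + 1} = {..<m} \<union> {m, m + 2}"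
    by auto
  then have oth: "others p (m + 1) r = a * r ^ m + c * r ^ (m + 2)" for r
    unfolding others_def deg using assms by (simp add: sum.union_disjoint cf)
  have dom: "inner_terms_dominant p \<longleftrightarrow> (\<exists>r>0. a + c * r\<^sup>2 \<le> b * r)"
  proof -
    have "others p (m + 1) r \<le> \<bar>coeff p (m + 1)\<bar> * r ^ (m + 1) \<longleftrightarrow> a + c * r\<^sup>2 \<le> b * r"
      if "r > 0" for r
    proof -
      have "others p (m + 1) r \<le> \<bar>coeff p (m + 1)\<bar> * r ^ (m + 1)
          \<longleftrightarrow> (a + c * r\<^sup>2) * r ^ m \<le> (b * r) * r ^ m"
        unfolding oth using assms by (simp add: cf algebra_simps power2_eq_square)
      then show ?thesis
        using that by simp
    qed
    moreover have "i < k \<and> k < degree p \<and> coeff p i \<noteq> 0 \<longleftrightarrow> i = m \<and> k = m + 1" for i k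
      using assms by (auto simp: cf deg)
    ultimately show ?thesis
      unfolding inner_terms_dominant_def by (metis (no_types, lifting))
  qed
  have "(\<exists>r>0. a + c * r\<^sup>2 \<le> b * r) \<longleftrightarrow> 4 * a * c \<le> b\<^sup>2"
  proof
    assume "\<exists>r>0. a + c * r\<^sup>2 \<le> b * r"
    then obtain r where "a + c * r\<^sup>2 \<le> b * r" by blast
    then have "4 * c * (a + c * r\<^sup>2) \<le> 4 * c * (b * r)"
      using assms by simp
    moreover have "(b - 2 * c * r)\<^sup>2 \<ge> 0"
      by simp
    ultimately show "4 * a * c \<le> b\<^sup>2"
      by (simp add: power2_eq_square algebra_simps)
  next
    assume "4 * a * c \<le> b\<^sup>2"
    \<comment> \<open>the minimum of \<open>a - b r + c r\<^sup>2\<close> is attained at \<open>b / (2 c)\<close>\<close>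
    then have "a + c * (b / (2 * c))\<^sup>2 \<le> b * (b / (2 * c))"
      using assms by (simp add: field_simps power2_eq_square)
    then show "\<exists>r>0. a + c * r\<^sup>2 \<le> b * r"
      using assms by (intro exI[of _ "b / (2 * c)"]) simp
  qed
  then show ?thesis
    using dom nz unfolding p_def[symmetric] sign_independently_real_rooted_iff by simp
qed

theorem corollary6:
  fixes l :: "nat \<Rightarrow> real"
  assumes "\<And>k. l k > 0"
  shows "diagonal_operator l ` {P. sign_independently_real_rooted P}
           \<subseteq> {P. sign_independently_real_rooted P}
         \<longleftrightarrow> log_concave l"
proof
  assume sub: "diagonal_operator l ` {P. sign_independently_real_rooted P}
           \<subseteq> {P. sign_independently_real_rooted P}"
  show "log_concave l"
    unfolding log_concave_def
  proof (intro allI impI)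
    fix k :: nat assume "k \<ge> 1"
    then obtain m where k: "k = Suc m"
      by (cases k) auto
    have "sign_independently_real_rooted (monom 1 m * [:1, 2, 1:])"
      by (subst sign_independently_real_rooted_trinomial) auto
    then have "sign_independently_real_rooted (diagonal_operator l (monom 1 m * [:1, 2, 1:]))"
      using sub by blast
    also have "diagonal_operator l (monom 1 m * [:1, 2, 1:])
        = monom 1 m * [:l m, 2 * l (m + 1), l (m + 2):]"
      unfolding poly_eq_iff coeff_diagonal_operator coeff_monom_mult
      by (auto simp: coeff_pCons not_less le_iff_add split: nat.splits)
    finally have "4 * l m * l (m + 2) \<le> (2 * l (m + 1))\<^sup>2"
      using assms by (subst (asm) sign_independently_real_rooted_trinomial) auto
    then show "l (k - 1) * l (k + 1) \<le> (l k)\<^sup>2"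
      by (simp add: k power2_eq_square)
  qed
next
  assume "log_concave l"
  then show "diagonal_operator l ` {P. sign_independently_real_rooted P}
           \<subseteq> {P. sign_independently_real_rooted P}"
    using log_concave_preserves assms by blast
qed

end
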